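(* Let $H$ be a group and $(S,1_S)$ a pointed set. Then there exists a bijection between the set of objects of the skeleton of the category $\mathcal{C}(H,(S,1_S))$ (i.e. the set of isomorphism classes of objects of this category) and the quotient set $\mathcal{K}^2_\ltimes(H,(S,1_S))$.
   Context: Let $H$ be a group with unit $1_H$. An extending datum of $H$ is a system $\Omega(H) = \bigl((S,1_S,\ast),\triangleleft,\triangleright,f\bigr)$ where $(S,1_S)$ is a pointed set (a nonempty set $S$ with a fixed element $1_S\in S$), and $\ast : S\times S\to S$, $\triangleleft : S\times H\to S$, $\triangleright : S\times H\to H$, $f : S\times S\to H$ are maps such that for all $s\in S$, $h\in H$: $s\ast 1_S = 1_S\ast s = s$, $s\triangleleft 1_H = s$, $1_S\triangleleft h = 1_S$, $1_S\triangleright h = h$, $s\triangleright 1_H = 1_H$, $f(s,1_S) = f(1_S,s) = 1_H$. For an extending datum $\Omega(H)$, $H\ltimes_\Omega S$ denotes the set $H\times S$ with the binary operation $$(h_1,s_1)\cdot(h_2,s_2) := \bigl(h_1(s_1\triangleright h_2)f(s_1\triangleleft h_2,s_2),\ (s_1\triangleleft h_2)\ast s_2\bigr).$$ $\Omega(H)$ is called a group extending structure of $H$ if $H\ltimes_\Omega S$ is a group with this multiplication; $H\ltimes_\Omega S$ is then called the unified product. Fix $H$ and $(S,1_S)$. $\mathcal{GES}(H,(S,1_S))$ denotes the set of all quadruples $(\ast,\triangleleft,\triangleright,f)$ such that $\bigl((S,1_S,\ast),\triangleleft,\triangleright,f\bigr)$ is a group extending structure of $H$. A morphism of groups $\psi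 : H\ltimes_\Omega S\to H\ltimes_{\Omega'}S$ stabilizes $H$ if $\psi(h,1_S) = (h,1_S)$ for all $h\in H$. The category $\mathcal{C}(H,(S,1_S))$ has $\mathcal{GES}(H,(S,1_S))$ as its class of objects, and a morphism $(\ast,\triangleleft,\triangleright,f)\to(\ast',\triangleleft',\triangleright',f')$ is a morphism of groups $\psi : H\ltimes_\Omega S\to H\ltimes_{\Omega'}S$ between the associated unified products that stabilizes $H$. Two elements $(\ast,\triangleleft,\triangleright,f)$ and $(\ast',\triangleleft',\triangleright',f')$ of $\mathcal{GES}(H,(S,1_S))$ are called equivalent, written $\sim$, if there exist maps $r : S\to H$ and $v : S\to S$ with $r(1_S) = 1_H$, $v(1_S) = 1_S$, $v$ bijective, such that for all $s,s_1,s_2\in S$, $h\in H$: $$v(s\triangleleft h) = v(s)\triangleleft' h,\qquad (s\triangleright h)\,r(s\triangleleft h) = r(s)\,\bigl(v(s)\triangleright' h\bigr),$$ $$v(s_1\ast s_2) = \bigl(v(s_1)\triangleleft' r(s_2)\bigr)\ast' v(s_2),$$ $$f(s_1,s_2)\,r(s_1\ast s_2) = r(s_1)\,\bigl(v(s_1)\triangleright' r(s_2)\bigr)\,f'\bigl(v(s_1)\triangleleft' r(s_2),\,v(s_2)\bigr).$$ The relation $\sim$ is an equivalence relation on $\mathcal{GES}(H,(S,1_S))$, and $\mathcal{K}^2_\ltimes(H,(S,1_S)) := \mathcal{GES}(H,(S,1_S))/\sim$. *)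

theory Defs
  imports "HOL-Algebra.Group"
begin

section \<open>Categories and isomorphism classes of objects\<close>

record ('o, 'm) cat =
  Obj :: "'o set"
  Hom :: "'o \<Rightarrow> 'o \<Rightarrow> 'm set"
  Ident :: "'o \<Rightarrow> 'm"
  Comp :: "'m \<Rightarrow> 'm \<Rightarrow> 'm"

text \<open>Hom-sets need not be disjoint; \<open>Comp C g f\<close> is the composite of \<open>g\<close> after \<open>f\<close>.\<close>

locale category =
  fixes C :: "('o, 'm) cat"
  assumes Id_in_Hom: "a \<in> Obj C \<Longrightarrow> Ident C a \<in> Hom C a a"
    and Comp_in_Hom: "\<lbrakk>a \<in> Obj C; b \<in> Obj C; c \<in> Obj C; f \<in> Hom C a b; g \<in> Hom C b c\<rbrakk>
      \<Longrightarrow> Comp C g f \<in> Hom C a c"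
    and Comp_Id: "\<lbrakk>a \<in> Obj C; b \<in> Obj C; f \<in> Hom C a b\<rbrakk> \<Longrightarrow> Comp C f (Ident C a) = f"
    and Id_Comp: "\<lbrakk>a \<in> Obj C; b \<in> Obj C; f \<in> Hom C a b\<rbrakk> \<Longrightarrow> Comp C (Ident C b) f = f"
    and Comp_assoc: "\<lbrakk>a \<in> Obj C; b \<in> Obj C; c \<in> Obj C; d \<in> Obj C;
        f \<in> Hom C a b; g \<in> Hom C b c; h \<in> Hom C c d\<rbrakk>
      \<Longrightarrow> Comp C h (Comp C g f) = Comp C (Comp C h g) f"

definition iso_rel :: "('o, 'm) cat \<Rightarrow> ('o \<times> 'o) set" where
  "iso_rel C = {(a, b). a \<in> Obj C \<and> b \<in> Obj C \<and>
     (\<exists>f \<in> Hom C a b. \<exists>g \<in> Hom C b a. Comp C g f = Ident C a \<and> Comp C f g = Ident C b)}"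

text \<open>The objects of the skeleton of \<open>C\<close>, up to the choice of representatives.\<close>

definition iso_classes :: "('o, 'm) cat \<Rightarrow> 'o set set" where
  "iso_classes C = Obj C // iso_rel C"

section \<open>Extending data and unified products\<close>

record ('h, 's) ext_maps =
  star :: "'s \<Rightarrow> 's \<Rightarrow> 's" (infixl "\<star>\<index>" 70)
  ract :: "'s \<Rightarrow> 'h \<Rightarrow> 's" (infixl "\<triangleleft>\<index>" 75)
  lact :: "'s \<Rightarrow> 'h \<Rightarrow> 'h" (infixr "\<triangleright>\<index>" 75)
  cocyc :: "'s \<Rightarrow> 's \<Rightarrow> 'h"

text \<open>
  The pointed set is \<open>(S, e)\<close>. The maps are curried and taken extensional, so that a quadruple
  is determined by its values on \<open>S\<close> and on the carrier of \<open>H\<close>.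
\<close>

definition extending_datum ::
  "('h, 'x) monoid_scheme \<Rightarrow> 's set \<Rightarrow> 's \<Rightarrow> ('h, 's) ext_maps \<Rightarrow> bool" where
  "extending_datum H S e \<Omega> \<longleftrightarrow>
     star \<Omega> \<in> S \<rightarrow>\<^sub>E S \<rightarrow>\<^sub>E S \<and>
     ract \<Omega> \<in> S \<rightarrow>\<^sub>E carrier H \<rightarrow>\<^sub>E S \<and>
     lact \<Omega> \<in> S \<rightarrow>\<^sub>E carrier H \<rightarrow>\<^sub>E carrier H \<and>
     cocyc \<Omega> \<in> S \<rightarrow>\<^sub>E S \<rightarrow>\<^sub>E carrier H \<and>
     (\<forall>s \<in> S. s \<star>\<^bsub>\<Omega>\<^esub> e = s \<and> e \<star>\<^bsub>\<Omega>\<^esub> s = s) \<and>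
     (\<forall>s \<in> S. s \<triangleleft>\<^bsub>\<Omega>\<^esub> \<one>\<^bsub>H\<^esub> = s) \<and>
     (\<forall>h \<in> carrier H. e \<triangleleft>\<^bsub>\<Omega>\<^esub> h = e) \<and>
     (\<forall>h \<in> carrier H. e \<triangleright>\<^bsub>\<Omega>\<^esub> h = h) \<and>
     (\<forall>s \<in> S. s \<triangleright>\<^bsub>\<Omega>\<^esub> \<one>\<^bsub>H\<^esub> = \<one>\<^bsub>H\<^esub>) \<and>
     (\<forall>s \<in> S. cocyc \<Omega> s e = \<one>\<^bsub>H\<^esub> \<and> cocyc \<Omega> e s = \<one>\<^bsub>H\<^esub>)"

text \<open>
  The monoid record requires a unit to be named; by the lemma \<open>unified_product_unit\<close> below,
  \<open>(\<one>, e)\<close> is the only possible one.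
\<close>

definition unified_product ::
  "('h, 'x) monoid_scheme \<Rightarrow> 's set \<Rightarrow> 's \<Rightarrow> ('h, 's) ext_maps \<Rightarrow> ('h \<times> 's) monoid" where
  "unified_product H S e \<Omega> =
     \<lparr>carrier = carrier H \<times> S,
      mult = (\<lambda>(h1, s1) (h2, s2).
        (h1 \<otimes>\<^bsub>H\<^esub> (s1 \<triangleright>\<^bsub>\<Omega>\<^esub> h2) \<otimes>\<^bsub>H\<^esub> cocyc \<Omega> (s1 \<triangleleft>\<^bsub>\<Omega>\<^esub> h2) s2,
         (s1 \<triangleleft>\<^bsub>\<Omega>\<^esub> h2) \<star>\<^bsub>\<Omega>\<^esub> s2)),
      one = (\<one>\<^bsub>H\<^esub>, e)\<rparr>"

lemma unified_product_unit:
  assumes "group H" "extending_datum H S e \<Omega>" "e \<in> S" "x \<in> carrier H \<times> S"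
  shows "(\<one>\<^bsub>H\<^esub>, e) \<otimes>\<^bsub>unified_product H S e \<Omega>\<^esub> x = x"
    and "x \<otimes>\<^bsub>unified_product H S e \<Omega>\<^esub> (\<one>\<^bsub>H\<^esub>, e) = x"
proof -
  interpret group H by fact
  show "(\<one>\<^bsub>H\<^esub>, e) \<otimes>\<^bsub>unified_product H S e \<Omega>\<^esub> x = x"
    and "x \<otimes>\<^bsub>unified_product H S e \<Omega>\<^esub> (\<one>\<^bsub>H\<^esub>, e) = x"
    using assms by (auto simp: unified_product_def extending_datum_def)
qed

definition GES ::
  "('h, 'x) monoid_scheme \<Rightarrow> 's set \<Rightarrow> 's \<Rightarrow> ('h, 's) ext_maps set" where
  "GES H S e = {\<Omega>. extending_datum H S e \<Omega> \<and> group (unified_product H S e \<Omega>)}"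

section \<open>The category of group extending structures\<close>

definition stabilizing_homs ::
  "('h, 'x) monoid_scheme \<Rightarrow> 's set \<Rightarrow> 's \<Rightarrow> ('h, 's) ext_maps \<Rightarrow> ('h, 's) ext_maps
    \<Rightarrow> ('h \<times> 's \<Rightarrow> 'h \<times> 's) set" where
  "stabilizing_homs H S e \<Omega> \<Omega>' =
     {\<psi> \<in> hom (unified_product H S e \<Omega>) (unified_product H S e \<Omega>').
        \<psi> \<in> extensional (carrier H \<times> S) \<and> (\<forall>h \<in> carrier H. \<psi> (h, e) = (h, e))}"

definition GES_cat ::
  "('h, 'x) monoid_scheme \<Rightarrow> 's set \<Rightarrow> 's
    \<Rightarrow> (('h, 's) ext_maps, 'h \<times> 's \<Rightarrow> 'h \<times> 's) cat" where
  "GES_cat H S e =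
     \<lparr>Obj = GES H S e,
      Hom = stabilizing_homs H S e,
      Ident = (\<lambda>_. \<lambda>x \<in> carrier H \<times> S. x),
      Comp = compose (carrier H \<times> S)\<rparr>"

lemma category_GES_cat:
  assumes "group H" "e \<in> S"
  shows "category (GES_cat H S e)"
proof -
  let ?P = "carrier H \<times> S"
  have carr: "carrier (unified_product H S e \<Omega>) = ?P" for \<Omega>
    by (simp add: unified_product_def)
  have maps: "\<psi> \<in> ?P \<rightarrow> ?P" if "\<psi> \<in> stabilizing_homs H S e \<Omega> \<Omega>'" for \<psi> \<Omega> \<Omega>'
    using that hom_carrier[of \<psi> "unified_product H S e \<Omega>" "unified_product H S e \<Omega>'"]
    by (auto simp: stabilizing_homs_def carr hom_def)
  have ext: "\<psi> \<in> extensional ?P" if "\<psi> \<in> stabilizing_homs H S e \<Omega> \<Omega>'" for \<psi> \<Omega> \<Omega>'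
    using that by (simp add: stabilizing_homs_def)
  have mult_closed: "x \<otimes>\<^bsub>unified_product H S e \<Omega>\<^esub> y \<in> ?P"
    if "\<Omega> \<in> GES H S e" "x \<in> ?P" "y \<in> ?P" for \<Omega> x y
  proof -
    interpret U: group "unified_product H S e \<Omega>" using that by (simp add: GES_def)
    show ?thesis using U.m_closed[of x y] that by (simp add: carr)
  qed
  show ?thesis
  proof (unfold_locales, goal_cases)
    case (1 a)
    then have "a \<in> GES H S e" by (simp add: GES_cat_def)
    then have "(\<lambda>x \<in> ?P. x) \<in> hom (unified_product H S e a) (unified_product H S e a)"
      by (intro homI) (simp_all add: carr mult_closed del: mem_Sigma_iff)
    then show ?case using assms by (simp add: GES_cat_def stabilizing_homs_def)
  next
    case (2 a b c f g)
    then have GES: "a \<in> GES H S e"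
      and f: "f \<in> stabilizing_homs H S e a b" and g: "g \<in> stabilizing_homs H S e b c"
      by (simp_all add: GES_cat_def)
    have fg: "f x \<in> ?P" "g x \<in> ?P" if "x \<in> ?P" for x
      using maps[OF f] maps[OF g] that by blast+
    have "compose ?P g f \<in> hom (unified_product H S e a) (unified_product H S e c)"
    proof (rule homI)
      fix x y
      assume "x \<in> carrier (unified_product H S e a)" "y \<in> carrier (unified_product H S e a)"
      then have xy: "x \<in> ?P" "y \<in> ?P" by (simp_all only: carr)
      have "f (x \<otimes>\<^bsub>unified_product H S e a\<^esub> y) = f x \<otimes>\<^bsub>unified_product H S e b\<^esub> f y"
        by (rule hom_mult) (use f xy in \<open>simp_all only: stabilizing_homs_def carr mem_Collect_eq\<close>)
      moreover have "g (f x \<otimes>\<^bsub>unified_product H S e b\<^esub> f y) =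
          g (f x) \<otimes>\<^bsub>unified_product H S e c\<^esub> g (f y)"
        by (rule hom_mult)
          (use g fg(1)[OF xy(1)] fg(1)[OF xy(2)] in
            \<open>simp_all only: stabilizing_homs_def carr mem_Collect_eq\<close>)
      ultimately show "compose ?P g f (x \<otimes>\<^bsub>unified_product H S e a\<^esub> y) =
          compose ?P g f x \<otimes>\<^bsub>unified_product H S e c\<^esub> compose ?P g f y"
        using mult_closed[OF GES xy] xy by (simp only: compose_eq)
    qed (simp add: carr fg compose_eq del: mem_Sigma_iff)
    then show ?case using f g assms
      by (simp add: GES_cat_def stabilizing_homs_def compose_eq)
  next
    case (3 a b f)
    then have "f \<in> extensional ?P" using ext by (simp add: GES_cat_def)
    then have "compose ?P f (\<lambda>x \<in> ?P. x) = f"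
      by (intro extensionalityI[of _ ?P]) (simp_all add: compose_eq del: mem_Sigma_iff)
    then show ?case by (simp add: GES_cat_def)
  next
    case (4 a b f)
    then have "f \<in> stabilizing_homs H S e a b" by (simp add: GES_cat_def)
    then have "compose ?P (\<lambda>x \<in> ?P. x) f = f" by (intro Id_compose maps ext)
    then show ?case by (simp add: GES_cat_def)
  next
    case (5 a b c d f g h)
    then have "f \<in> ?P \<rightarrow> ?P" using maps by (simp add: GES_cat_def)
    then have "compose ?P h (compose ?P g f) = compose ?P (compose ?P h g) f"
      by (rule compose_assoc)
    then show ?case by (simp add: GES_cat_def)
  qed
qed

section \<open>The equivalence of group extending structures\<close>

definition ges_equiv ::
  "('h, 'x) monoid_scheme \<Rightarrow> 's set \<Rightarrow> 's \<Rightarrow> (('h, 's) ext_maps \<times> ('h, 's) ext_maps) set" where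
  "ges_equiv H S e = {(\<Omega>, \<Omega>'). \<Omega> \<in> GES H S e \<and> \<Omega>' \<in> GES H S e \<and>
     (\<exists>r v. r \<in> S \<rightarrow> carrier H \<and> bij_betw v S S \<and> r e = \<one>\<^bsub>H\<^esub> \<and> v e = e \<and>
        (\<forall>s \<in> S. \<forall>h \<in> carrier H. v (s \<triangleleft>\<^bsub>\<Omega>\<^esub> h) = v s \<triangleleft>\<^bsub>\<Omega>'\<^esub> h) \<and>
        (\<forall>s \<in> S. \<forall>h \<in> carrier H.
           (s \<triangleright>\<^bsub>\<Omega>\<^esub> h) \<otimes>\<^bsub>H\<^esub> r (s \<triangleleft>\<^bsub>\<Omega>\<^esub> h) = r s \<otimes>\<^bsub>H\<^esub> (v s \<triangleright>\<^bsub>\<Omega>'\<^esub> h)) \<and>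
        (\<forall>s1 \<in> S. \<forall>s2 \<in> S. v (s1 \<star>\<^bsub>\<Omega>\<^esub> s2) = (v s1 \<triangleleft>\<^bsub>\<Omega>'\<^esub> r s2) \<star>\<^bsub>\<Omega>'\<^esub> v s2) \<and>
        (\<forall>s1 \<in> S. \<forall>s2 \<in> S.
           cocyc \<Omega> s1 s2 \<otimes>\<^bsub>H\<^esub> r (s1 \<star>\<^bsub>\<Omega>\<^esub> s2) =
           r s1 \<otimes>\<^bsub>H\<^esub> (v s1 \<triangleright>\<^bsub>\<Omega>'\<^esub> r s2) \<otimes>\<^bsub>H\<^esub> cocyc \<Omega>' (v s1 \<triangleleft>\<^bsub>\<Omega>'\<^esub> r s2) (v s2)))}"

definition K2 :: "('h, 'x) monoid_scheme \<Rightarrow> 's set \<Rightarrow> 's \<Rightarrow> ('h, 's) ext_maps set set" where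
  "K2 H S e = GES H S e // ges_equiv H S e"

end

theory Submission
  imports Defs
begin

text \<open>
  The isomorphism relation of the category and the equivalence \<open>\<sim>\<close> are the same relation on group
  extending structures, so the two quotients coincide and the identity is a bijection between them.

  The relations agree because of the factorisation \<open>(h, s) = (h, e) \<cdot> (\<one>, s)\<close>, valid in every
  unified product. A morphism \<open>\<psi>\<close> that stabilizes \<open>H\<close> is thus determined by the values
  \<open>\<psi> (\<one>, s) = (r s, v s)\<close>: it is \<open>(h, s) \<mapsto> (h \<cdot> r s, v s)\<close>
  (\<open>stabilizing_hom_eq_twist\<close>). Multiplicativity needs testing only on the products
  \<open>(\<one>, s) \<cdot> (h, e)\<close> and \<open>(\<one>, s\<^sub>1) \<cdot> (\<one>, s\<^sub>2)\<close>, since \<open>H \<times> {e}\<close> and \<open>{\<one>} \<times> S\<close> together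
  generate; comparing components there gives exactly the four compatibility conditions
  on \<open>(r, v)\<close> (\<open>compatible_if_hom\<close>, \<open>twist_hom\<close>). Finally, right translation by \<open>r s\<close>
  permutes \<open>H\<close>, so the morphism is invertible precisely when \<open>v\<close> is a bijection.
\<close>

lemma carrier_unified_product: "carrier (unified_product H S e \<Omega>) = carrier H \<times> S"
  by (simp add: unified_product_def)

lemma mult_unified_product:
  "(h1, s1) \<otimes>\<^bsub>unified_product H S e \<Omega>\<^esub> (h2, s2) =
     (h1 \<otimes>\<^bsub>H\<^esub> (s1 \<triangleright>\<^bsub>\<Omega>\<^esub> h2) \<otimes>\<^bsub>H\<^esub> cocyc \<Omega> (s1 \<triangleleft>\<^bsub>\<Omega>\<^esub> h2) s2,
      (s1 \<triangleleft>\<^bsub>\<Omega>\<^esub> h2) \<star>\<^bsub>\<Omega>\<^esub> s2)"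
  by (simp add: unified_product_def)

text \<open>The part of \<open>\<sim>\<close> that does not speak of bijectivity; it characterises arbitrary
  morphisms that stabilize \<open>H\<close>, whereas bijectivity of \<open>v\<close> singles out the isomorphisms.\<close>

definition compatible ::
  "('h, 'x) monoid_scheme \<Rightarrow> 's set \<Rightarrow> 's \<Rightarrow> ('h, 's) ext_maps \<Rightarrow> ('h, 's) ext_maps
    \<Rightarrow> ('s \<Rightarrow> 'h) \<Rightarrow> ('s \<Rightarrow> 's) \<Rightarrow> bool" where
  "compatible H S e \<Omega> \<Omega>' r v \<longleftrightarrow>
     r \<in> S \<rightarrow> carrier H \<and> v \<in> S \<rightarrow> S \<and> r e = \<one>\<^bsub>H\<^esub> \<and> v e = e \<and>
     (\<forall>s \<in> S. \<forall>h \<in> carrier H. v (s \<triangleleft>\<^bsub>\<Omega>\<^esub> h) = v s \<triangleleft>\<^bsub>\<Omega>'\<^esub> h) \<and>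
     (\<forall>s \<in> S. \<forall>h \<in> carrier H.
        (s \<triangleright>\<^bsub>\<Omega>\<^esub> h) \<otimes>\<^bsub>H\<^esub> r (s \<triangleleft>\<^bsub>\<Omega>\<^esub> h) = r s \<otimes>\<^bsub>H\<^esub> (v s \<triangleright>\<^bsub>\<Omega>'\<^esub> h)) \<and>
     (\<forall>s1 \<in> S. \<forall>s2 \<in> S. v (s1 \<star>\<^bsub>\<Omega>\<^esub> s2) = (v s1 \<triangleleft>\<^bsub>\<Omega>'\<^esub> r s2) \<star>\<^bsub>\<Omega>'\<^esub> v s2) \<and>
     (\<forall>s1 \<in> S. \<forall>s2 \<in> S.
        cocyc \<Omega> s1 s2 \<otimes>\<^bsub>H\<^esub> r (s1 \<star>\<^bsub>\<Omega>\<^esub> s2) =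
        r s1 \<otimes>\<^bsub>H\<^esub> (v s1 \<triangleright>\<^bsub>\<Omega>'\<^esub> r s2) \<otimes>\<^bsub>H\<^esub> cocyc \<Omega>' (v s1 \<triangleleft>\<^bsub>\<Omega>'\<^esub> r s2) (v s2))"

lemma ges_equiv_iff_compatible:
  "(\<Omega>, \<Omega>') \<in> ges_equiv H S e \<longleftrightarrow>
     \<Omega> \<in> GES H S e \<and> \<Omega>' \<in> GES H S e \<and> (\<exists>r v. compatible H S e \<Omega> \<Omega>' r v \<and> bij_betw v S S)"
  unfolding ges_equiv_def compatible_def
  using bij_betw_imp_funcset[of _ S S] by (simp, blast)

definition twist ::
  "('h, 'x) monoid_scheme \<Rightarrow> 's set \<Rightarrow> ('s \<Rightarrow> 'h) \<Rightarrow> ('s \<Rightarrow> 's) \<Rightarrow> 'h \<times> 's \<Rightarrow> 'h \<times> 's" where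
  "twist H S r v = (\<lambda>x \<in> carrier H \<times> S. (fst x \<otimes>\<^bsub>H\<^esub> r (snd x), v (snd x)))"

lemma twist_apply:
  "\<lbrakk>h \<in> carrier H; s \<in> S\<rbrakk> \<Longrightarrow> twist H S r v (h, s) = (h \<otimes>\<^bsub>H\<^esub> r s, v s)"
  by (simp add: twist_def)

context
  fixes H :: "('h, 'x) monoid_scheme" and S :: "'s set" and e :: 's
  assumes H: "group H" and e: "e \<in> S"
begin

interpretation H: group H by (fact H)

lemma GES_closed:
  assumes "\<Omega> \<in> GES H S e" "s \<in> S"
  shows "t \<in> S \<Longrightarrow> s \<star>\<^bsub>\<Omega>\<^esub> t \<in> S"
    and "h \<in> carrier H \<Longrightarrow> s \<triangleleft>\<^bsub>\<Omega>\<^esub> h \<in> S"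
    and "h \<in> carrier H \<Longrightarrow> s \<triangleright>\<^bsub>\<Omega>\<^esub> h \<in> carrier H"
    and "t \<in> S \<Longrightarrow> cocyc \<Omega> s t \<in> carrier H"
  using assms by (auto simp: GES_def extending_datum_def PiE_iff)

lemma GES_unit:
  assumes "\<Omega> \<in> GES H S e"
  shows "s \<in> S \<Longrightarrow> s \<star>\<^bsub>\<Omega>\<^esub> e = s" "s \<in> S \<Longrightarrow> e \<star>\<^bsub>\<Omega>\<^esub> s = s"
    and "s \<in> S \<Longrightarrow> s \<triangleleft>\<^bsub>\<Omega>\<^esub> \<one>\<^bsub>H\<^esub> = s" "h \<in> carrier H \<Longrightarrow> e \<triangleleft>\<^bsub>\<Omega>\<^esub> h = e"
    and "h \<in> carrier H \<Longrightarrow> e \<triangleright>\<^bsub>\<Omega>\<^esub> h = h" "s \<in> S \<Longrightarrow> s \<triangleright>\<^bsub>\<Omega>\<^esub> \<one>\<^bsub>H\<^esub> = \<one>\<^bsub>H\<^esub>"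
    and "s \<in> S \<Longrightarrow> cocyc \<Omega> s e = \<one>\<^bsub>H\<^esub>" "s \<in> S \<Longrightarrow> cocyc \<Omega> e s = \<one>\<^bsub>H\<^esub>"
  using assms by (auto simp: GES_def extending_datum_def)

lemma unified_product_group: "\<Omega> \<in> GES H S e \<Longrightarrow> group (unified_product H S e \<Omega>)"
  by (simp add: GES_def)

text \<open>The normalisation conditions of an extending datum shorten the product when the left or the
  right factor lies in \<open>H \<times> {e}\<close>, or when both lie in \<open>{\<one>} \<times> S\<close>. These cases carry the whole
  argument, because \<open>H \<times> {e}\<close> and \<open>{\<one>} \<times> S\<close> generate the unified product.\<close>

lemma mult_H_left:
  assumes "\<Omega> \<in> GES H S e" "h \<in> carrier H" "k \<in> carrier H" "s \<in> S"
  shows "(h, e) \<otimes>\<^bsub>unified_product H S e \<Omega>\<^esub> (k, s) = (h \<otimes>\<^bsub>H\<^esub> k, s)"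
  using assms e by (simp add: mult_unified_product GES_unit)

lemma mult_H_right:
  assumes "\<Omega> \<in> GES H S e" "k \<in> carrier H" "s \<in> S" "h \<in> carrier H"
  shows "(k, s) \<otimes>\<^bsub>unified_product H S e \<Omega>\<^esub> (h, e) = (k \<otimes>\<^bsub>H\<^esub> (s \<triangleright>\<^bsub>\<Omega>\<^esub> h), s \<triangleleft>\<^bsub>\<Omega>\<^esub> h)"
  using assms e by (simp add: mult_unified_product GES_unit GES_closed)

lemma mult_S_S:
  assumes "\<Omega> \<in> GES H S e" "s \<in> S" "t \<in> S"
  shows "(\<one>\<^bsub>H\<^esub>, s) \<otimes>\<^bsub>unified_product H S e \<Omega>\<^esub> (\<one>\<^bsub>H\<^esub>, t) = (cocyc \<Omega> s t, s \<star>\<^bsub>\<Omega>\<^esub> t)"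
  using assms by (simp add: mult_unified_product GES_unit GES_closed)

lemma stabilizing_hom_eq_twist:
  assumes \<Omega>: "\<Omega> \<in> GES H S e" and \<Omega>': "\<Omega>' \<in> GES H S e"
    and \<psi>: "\<psi> \<in> stabilizing_homs H S e \<Omega> \<Omega>'"
  obtains r v where "r \<in> S \<rightarrow> carrier H" "v \<in> S \<rightarrow> S" "r e = \<one>\<^bsub>H\<^esub>" "v e = e"
    "\<psi> = twist H S r v"
proof
  define r where "r s = fst (\<psi> (\<one>\<^bsub>H\<^esub>, s))" for s
  define v where "v s = snd (\<psi> (\<one>\<^bsub>H\<^esub>, s))" for s
  have hom: "\<psi> \<in> hom (unified_product H S e \<Omega>) (unified_product H S e \<Omega>')"
    and fix_H: "\<And>h. h \<in> carrier H \<Longrightarrow> \<psi> (h, e) = (h, e)"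
    and ext: "\<psi> \<in> extensional (carrier H \<times> S)"
    using \<psi> by (auto simp: stabilizing_homs_def)
  have "\<psi> (\<one>\<^bsub>H\<^esub>, s) \<in> carrier H \<times> S" if "s \<in> S" for s
    using hom_in_carrier[OF hom, of "(\<one>\<^bsub>H\<^esub>, s)"] that by (simp add: carrier_unified_product)
  then have rv: "r s \<in> carrier H" "v s \<in> S" if "s \<in> S" for s
    using that by (auto simp: r_def v_def mem_Times_iff)
  then show "r \<in> S \<rightarrow> carrier H" "v \<in> S \<rightarrow> S" by auto
  show "r e = \<one>\<^bsub>H\<^esub>" "v e = e" by (simp_all add: r_def v_def fix_H)
  show "\<psi> = twist H S r v"
  proof (rule extensionalityI[OF ext])
    fix x assume "x \<in> carrier H \<times> S"
    then obtain h s where x: "x = (h, s)" "h \<in> carrier H" "s \<in> S" by auto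
    have "\<psi> (h, s) = \<psi> ((h, e) \<otimes>\<^bsub>unified_product H S e \<Omega>\<^esub> (\<one>\<^bsub>H\<^esub>, s))"
      using x by (simp add: mult_H_left[OF \<Omega>])
    also have "\<dots> = \<psi> (h, e) \<otimes>\<^bsub>unified_product H S e \<Omega>'\<^esub> \<psi> (\<one>\<^bsub>H\<^esub>, s)"
      using x e by (intro hom_mult[OF hom]) (simp_all add: carrier_unified_product)
    also have "\<dots> = (h, e) \<otimes>\<^bsub>unified_product H S e \<Omega>'\<^esub> (r s, v s)"
      using x by (simp add: fix_H r_def v_def)
    also have "\<dots> = (h \<otimes>\<^bsub>H\<^esub> r s, v s)"
      using x rv by (simp add: mult_H_left[OF \<Omega>'])
    finally show "\<psi> x = twist H S r v x" using x by (simp add: twist_apply)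
  qed (simp add: twist_def)
qed

text \<open>The first two conditions compare the components of the images of \<open>(\<one>, s) \<cdot> (h, e)\<close>
  and its factors, the last two those of \<open>(\<one>, s\<^sub>1) \<cdot> (\<one>, s\<^sub>2)\<close> and its factors.\<close>

lemma compatible_if_hom:
  assumes \<Omega>: "\<Omega> \<in> GES H S e" and \<Omega>': "\<Omega>' \<in> GES H S e"
    and r: "r \<in> S \<rightarrow> carrier H" "r e = \<one>\<^bsub>H\<^esub>" and v: "v \<in> S \<rightarrow> S" "v e = e"
    and hom: "twist H S r v \<in> hom (unified_product H S e \<Omega>) (unified_product H S e \<Omega>')"
  shows "compatible H S e \<Omega> \<Omega>' r v"
proof -
  note closed = GES_closed[OF \<Omega>] GES_closed[OF \<Omega>'] funcset_mem[OF r(1)] funcset_mem[OF v(1)]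
  have "((s \<triangleright>\<^bsub>\<Omega>\<^esub> h) \<otimes>\<^bsub>H\<^esub> r (s \<triangleleft>\<^bsub>\<Omega>\<^esub> h), v (s \<triangleleft>\<^bsub>\<Omega>\<^esub> h)) =
      (r s \<otimes>\<^bsub>H\<^esub> (v s \<triangleright>\<^bsub>\<Omega>'\<^esub> h), v s \<triangleleft>\<^bsub>\<Omega>'\<^esub> h)" if "s \<in> S" "h \<in> carrier H" for s h
    using hom_mult[OF hom, of "(\<one>\<^bsub>H\<^esub>, s)" "(h, e)"] that e r(2) v(2)
    by (simp add: carrier_unified_product mult_H_right[OF \<Omega>] mult_H_right[OF \<Omega>'] twist_apply closed)
  moreover have "(cocyc \<Omega> s t \<otimes>\<^bsub>H\<^esub> r (s \<star>\<^bsub>\<Omega>\<^esub> t), v (s \<star>\<^bsub>\<Omega>\<^esub> t)) =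
      (r s \<otimes>\<^bsub>H\<^esub> (v s \<triangleright>\<^bsub>\<Omega>'\<^esub> r t) \<otimes>\<^bsub>H\<^esub> cocyc \<Omega>' (v s \<triangleleft>\<^bsub>\<Omega>'\<^esub> r t) (v t),
       (v s \<triangleleft>\<^bsub>\<Omega>'\<^esub> r t) \<star>\<^bsub>\<Omega>'\<^esub> v t)" if "s \<in> S" "t \<in> S" for s t
    using hom_mult[OF hom, of "(\<one>\<^bsub>H\<^esub>, s)" "(\<one>\<^bsub>H\<^esub>, t)"] that
    by (simp add: carrier_unified_product mult_S_S[OF \<Omega>] twist_apply closed
        mult_unified_product[where \<Omega> = \<Omega>'])
  ultimately show ?thesis using r v by (simp add: compatible_def)
qed

text \<open>Multiplicativity spreads from the two tested kinds of product to all of them by associativity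
  in both groups, because the map commutes with left multiplication by \<open>H \<times> {e}\<close>.\<close>

lemma twist_hom:
  assumes \<Omega>: "\<Omega> \<in> GES H S e" and \<Omega>': "\<Omega>' \<in> GES H S e"
    and compat: "compatible H S e \<Omega> \<Omega>' r v"
  shows "twist H S r v \<in> hom (unified_product H S e \<Omega>) (unified_product H S e \<Omega>')"
proof -
  let ?\<psi> = "twist H S r v" and ?P = "carrier H \<times> S"
  let ?G = "unified_product H S e \<Omega>" and ?G' = "unified_product H S e \<Omega>'"
  interpret G: group ?G by (rule unified_product_group[OF \<Omega>])
  interpret G': group ?G' by (rule unified_product_group[OF \<Omega>'])
  have r: "r s \<in> carrier H" and v: "v s \<in> S" if "s \<in> S" for s
    using compat that by (auto simp: compatible_def)
  note closed = GES_closed[OF \<Omega>] GES_closed[OF \<Omega>'] r v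
  have unit: "r e = \<one>\<^bsub>H\<^esub>" "v e = e" using compat by (auto simp: compatible_def)
  have G_in: "x \<in> ?P \<Longrightarrow> y \<in> ?P \<Longrightarrow> x \<otimes>\<^bsub>?G\<^esub> y \<in> ?P"
    and G_assoc: "x \<in> ?P \<Longrightarrow> y \<in> ?P \<Longrightarrow> z \<in> ?P \<Longrightarrow>
      (x \<otimes>\<^bsub>?G\<^esub> y) \<otimes>\<^bsub>?G\<^esub> z = x \<otimes>\<^bsub>?G\<^esub> (y \<otimes>\<^bsub>?G\<^esub> z)"
    and G'_assoc: "x \<in> ?P \<Longrightarrow> y \<in> ?P \<Longrightarrow> z \<in> ?P \<Longrightarrow>
      (x \<otimes>\<^bsub>?G'\<^esub> y) \<otimes>\<^bsub>?G'\<^esub> z = x \<otimes>\<^bsub>?G'\<^esub> (y \<otimes>\<^bsub>?G'\<^esub> z)" for x y z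
    using G.m_closed[of x y] G.m_assoc[of x y z] G'.m_assoc[of x y z]
    by (simp_all only: carrier_unified_product)
  have \<psi>_in: "?\<psi> x \<in> ?P" if "x \<in> ?P" for x
    using that by (auto simp: twist_apply r v)
  have left_H: "?\<psi> ((h, e) \<otimes>\<^bsub>?G\<^esub> x) = (h, e) \<otimes>\<^bsub>?G'\<^esub> ?\<psi> x" if "h \<in> carrier H" "x \<in> ?P" for h x
    using that
    by (auto simp: mult_H_left[OF \<Omega>] mult_H_left[OF \<Omega>'] twist_apply r v H.m_assoc)
  have S_H: "?\<psi> ((\<one>\<^bsub>H\<^esub>, s) \<otimes>\<^bsub>?G\<^esub> (h, e)) = ?\<psi> (\<one>\<^bsub>H\<^esub>, s) \<otimes>\<^bsub>?G'\<^esub> (h, e)"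
    if "s \<in> S" "h \<in> carrier H" for s h
    using that compat
    by (simp add: mult_H_right[OF \<Omega>] mult_H_right[OF \<Omega>'] twist_apply closed compatible_def)
  have S_S: "?\<psi> ((\<one>\<^bsub>H\<^esub>, s) \<otimes>\<^bsub>?G\<^esub> (\<one>\<^bsub>H\<^esub>, t)) = ?\<psi> (\<one>\<^bsub>H\<^esub>, s) \<otimes>\<^bsub>?G'\<^esub> ?\<psi> (\<one>\<^bsub>H\<^esub>, t)"
    if "s \<in> S" "t \<in> S" for s t
    using that compat
    by (simp add: mult_S_S[OF \<Omega>] mult_unified_product[where \<Omega> = \<Omega>'] twist_apply closed
        compatible_def)
  \<comment> \<open>A left factor \<open>x = (h, e) \<cdot> (\<one>, s)\<close> may be replaced by \<open>(\<one>, s)\<close>.\<close>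
  have from_S: "?\<psi> (x \<otimes>\<^bsub>?G\<^esub> z) = ?\<psi> x \<otimes>\<^bsub>?G'\<^esub> ?\<psi> z"
    if x: "x \<in> ?P" and z: "z \<in> ?P"
      and S_z: "\<And>s. s \<in> S \<Longrightarrow>
        ?\<psi> ((\<one>\<^bsub>H\<^esub>, s) \<otimes>\<^bsub>?G\<^esub> z) = ?\<psi> (\<one>\<^bsub>H\<^esub>, s) \<otimes>\<^bsub>?G'\<^esub> ?\<psi> z"
    for x z
  proof -
    obtain h s where hs: "x = (h, s)" "h \<in> carrier H" "s \<in> S" using x by auto
    have mem: "(h, e) \<in> ?P" "(\<one>\<^bsub>H\<^esub>, s) \<in> ?P" using hs e by auto
    have x_eq: "x = (h, e) \<otimes>\<^bsub>?G\<^esub> (\<one>\<^bsub>H\<^esub>, s)" using hs by (simp add: mult_H_left[OF \<Omega>])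
    have "?\<psi> (x \<otimes>\<^bsub>?G\<^esub> z) = (h, e) \<otimes>\<^bsub>?G'\<^esub> ?\<psi> ((\<one>\<^bsub>H\<^esub>, s) \<otimes>\<^bsub>?G\<^esub> z)"
      unfolding x_eq by (simp only: G_assoc mem z left_H G_in hs)
    also have "\<dots> = ((h, e) \<otimes>\<^bsub>?G'\<^esub> ?\<psi> (\<one>\<^bsub>H\<^esub>, s)) \<otimes>\<^bsub>?G'\<^esub> ?\<psi> z"
      by (simp only: S_z hs z G'_assoc mem \<psi>_in)
    also have "(h, e) \<otimes>\<^bsub>?G'\<^esub> ?\<psi> (\<one>\<^bsub>H\<^esub>, s) = ?\<psi> x"
      unfolding x_eq by (simp only: left_H hs mem)
    finally show ?thesis .
  qed
  have fix_H: "?\<psi> (h, e) = (h, e)" if "h \<in> carrier H" for h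
    using that e by (simp add: twist_apply unit)
  show ?thesis
  proof (rule homI)
    fix x y assume "x \<in> carrier ?G" "y \<in> carrier ?G"
    then have x: "x \<in> ?P" and y: "y \<in> ?P" by (simp_all only: carrier_unified_product)
    then obtain k t where kt: "y = (k, t)" "k \<in> carrier H" "t \<in> S" by auto
    have mem: "(k, e) \<in> ?P" "(\<one>\<^bsub>H\<^esub>, t) \<in> ?P" using kt e by auto
    have y_eq: "y = (k, e) \<otimes>\<^bsub>?G\<^esub> (\<one>\<^bsub>H\<^esub>, t)" using kt by (simp add: mult_H_left[OF \<Omega>])
    have "?\<psi> (x \<otimes>\<^bsub>?G\<^esub> y) = ?\<psi> ((x \<otimes>\<^bsub>?G\<^esub> (k, e)) \<otimes>\<^bsub>?G\<^esub> (\<one>\<^bsub>H\<^esub>, t))"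
      unfolding y_eq by (simp only: G_assoc mem x)
    also have "\<dots> = (?\<psi> x \<otimes>\<^bsub>?G'\<^esub> (k, e)) \<otimes>\<^bsub>?G'\<^esub> ?\<psi> (\<one>\<^bsub>H\<^esub>, t)"
      by (simp only: from_S S_S S_H fix_H G_in mem x kt)
    also have "\<dots> = ?\<psi> x \<otimes>\<^bsub>?G'\<^esub> ((k, e) \<otimes>\<^bsub>?G'\<^esub> ?\<psi> (\<one>\<^bsub>H\<^esub>, t))"
      by (simp only: G'_assoc \<psi>_in mem x)
    also have "(k, e) \<otimes>\<^bsub>?G'\<^esub> ?\<psi> (\<one>\<^bsub>H\<^esub>, t) = ?\<psi> y"
      unfolding y_eq by (simp only: left_H kt mem)
    finally show "?\<psi> (x \<otimes>\<^bsub>?G\<^esub> y) = ?\<psi> x \<otimes>\<^bsub>?G'\<^esub> ?\<psi> y" .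
  qed (simp only: carrier_unified_product \<psi>_in)
qed

lemma twist_stabilizing:
  assumes "\<Omega> \<in> GES H S e" "\<Omega>' \<in> GES H S e" "compatible H S e \<Omega> \<Omega>' r v"
  shows "twist H S r v \<in> stabilizing_homs H S e \<Omega> \<Omega>'"
  using assms e twist_hom[OF assms]
  by (simp add: stabilizing_homs_def twist_apply compatible_def) (simp add: twist_def)

lemma twist_bij:
  assumes r: "\<And>s. s \<in> S \<Longrightarrow> r s \<in> carrier H" and v: "bij_betw v S S"
  shows "bij_betw (twist H S r v) (carrier H \<times> S) (carrier H \<times> S)"
proof (rule bij_betw_byWitness)
  \<comment> \<open>Invert \<open>v\<close> first; this reveals which \<open>r s\<close> to cancel.\<close>
  let ?w = "inv_into S v"
  let ?g = "\<lambda>(h, s). (h \<otimes>\<^bsub>H\<^esub> inv\<^bsub>H\<^esub> r (?w s), ?w s)"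
  have w: "?w s \<in> S" "v (?w s) = s" "?w (v s) = s" "v s \<in> S" if "s \<in> S" for s
    using v that bij_betw_inv_into_left[OF v that] bij_betw_inv_into_right[OF v that]
      bij_betw_apply[OF bij_betw_inv_into[OF v] that] bij_betw_apply[OF v that] by auto
  show "\<forall>x \<in> carrier H \<times> S. ?g (twist H S r v x) = x"
    by (auto simp: twist_apply w r H.m_assoc)
  show "\<forall>x \<in> carrier H \<times> S. twist H S r v (?g x) = x"
    by (auto simp: twist_apply w r H.m_assoc)
  show "twist H S r v ` (carrier H \<times> S) \<subseteq> carrier H \<times> S"
    by (auto simp: twist_apply w r)
  show "?g ` (carrier H \<times> S) \<subseteq> carrier H \<times> S"
    by (auto simp: w r)
qed

lemma iso_imp_ges_equiv:
  assumes "(\<Omega>, \<Omega>') \<in> iso_rel (GES_cat H S e)"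
  shows "(\<Omega>, \<Omega>') \<in> ges_equiv H S e"
proof -
  let ?P = "carrier H \<times> S"
  from assms obtain \<psi> \<chi> where \<Omega>: "\<Omega> \<in> GES H S e" and \<Omega>': "\<Omega>' \<in> GES H S e"
    and \<psi>: "\<psi> \<in> stabilizing_homs H S e \<Omega> \<Omega>'" and \<chi>: "\<chi> \<in> stabilizing_homs H S e \<Omega>' \<Omega>"
    and inv: "compose ?P \<chi> \<psi> = (\<lambda>x \<in> ?P. x)" "compose ?P \<psi> \<chi> = (\<lambda>x \<in> ?P. x)"
    by (auto simp: iso_rel_def GES_cat_def)
  obtain r v where r: "r \<in> S \<rightarrow> carrier H" "r e = \<one>\<^bsub>H\<^esub>" and v: "v \<in> S \<rightarrow> S" "v e = e"
    and \<psi>_eq: "\<psi> = twist H S r v" by (rule stabilizing_hom_eq_twist[OF \<Omega> \<Omega>' \<psi>])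
  obtain q w where q: "q \<in> S \<rightarrow> carrier H" and w: "w \<in> S \<rightarrow> S"
    and \<chi>_eq: "\<chi> = twist H S q w" by (rule stabilizing_hom_eq_twist[OF \<Omega>' \<Omega> \<chi>])
  have "w (v s) = s \<and> v (w s) = s" if s: "s \<in> S" for s
  proof -
    \<comment> \<open>The second components of the two composites, read off at \<open>(\<one>, s)\<close>.\<close>
    have "\<chi> (\<psi> (\<one>\<^bsub>H\<^esub>, s)) = (\<one>\<^bsub>H\<^esub>, s)" "\<psi> (\<chi> (\<one>\<^bsub>H\<^esub>, s)) = (\<one>\<^bsub>H\<^esub>, s)"
      using fun_cong[OF inv(1), of "(\<one>\<^bsub>H\<^esub>, s)"] fun_cong[OF inv(2), of "(\<one>\<^bsub>H\<^esub>, s)"] s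
      by (simp_all add: compose_eq)
    then show ?thesis
      using s r(1) v(1) q w by (simp add: \<psi>_eq \<chi>_eq twist_apply Pi_iff)
  qed
  then have "bij_betw v S S"
    using v w by (intro bij_betw_byWitness[where f' = w]) auto
  moreover have "compatible H S e \<Omega> \<Omega>' r v"
    using \<psi> by (intro compatible_if_hom \<Omega> \<Omega>' r v) (simp add: \<psi>_eq stabilizing_homs_def)
  ultimately show ?thesis using \<Omega> \<Omega>' by (auto simp: ges_equiv_iff_compatible)
qed

lemma ges_equiv_imp_iso:
  assumes "(\<Omega>, \<Omega>') \<in> ges_equiv H S e"
  shows "(\<Omega>, \<Omega>') \<in> iso_rel (GES_cat H S e)"
proof -
  let ?P = "carrier H \<times> S"
  let ?G = "unified_product H S e \<Omega>" and ?G' = "unified_product H S e \<Omega>'"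
  from assms obtain r v where \<Omega>: "\<Omega> \<in> GES H S e" and \<Omega>': "\<Omega>' \<in> GES H S e"
    and compat: "compatible H S e \<Omega> \<Omega>' r v" and v: "bij_betw v S S"
    by (auto simp: ges_equiv_iff_compatible)
  interpret G: group ?G by (rule unified_product_group[OF \<Omega>])
  let ?\<psi> = "twist H S r v"
  define \<chi> where "\<chi> = restrict (inv_into ?P ?\<psi>) ?P"
  have \<psi>: "?\<psi> \<in> stabilizing_homs H S e \<Omega> \<Omega>'" by (rule twist_stabilizing[OF \<Omega> \<Omega>' compat])
  have bij: "bij_betw ?\<psi> ?P ?P"
    using compat by (intro twist_bij v) (auto simp: compatible_def)
  have "?\<psi> \<in> iso ?G ?G'"
    using \<psi> bij by (simp add: iso_def stabilizing_homs_def carrier_unified_product)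
  then have "inv_into ?P ?\<psi> \<in> hom ?G' ?G"
    using G.iso_set_sym[of ?\<psi> ?G'] by (simp add: iso_def carrier_unified_product)
  then have hom: "\<chi> \<in> hom ?G' ?G"
    unfolding \<chi>_def
    by (rule group.hom_restrict[OF unified_product_group[OF \<Omega>']])
      (simp add: carrier_unified_product)
  have "\<chi> (h, e) = (h, e)" if "h \<in> carrier H" for h
  proof -
    have "?\<psi> (h, e) = (h, e)" using \<psi> that by (simp add: stabilizing_homs_def)
    then show ?thesis
      using bij_betw_inv_into_left[OF bij, of "(h, e)"] that e by (simp add: \<chi>_def)
  qed
  then have \<chi>: "\<chi> \<in> stabilizing_homs H S e \<Omega>' \<Omega>"
    using hom by (simp add: stabilizing_homs_def) (simp add: \<chi>_def)
  have "compose ?P \<chi> ?\<psi> = (\<lambda>x \<in> ?P. x)" "compose ?P ?\<psi> \<chi> = (\<lambda>x \<in> ?P. x)"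
    unfolding compose_def \<chi>_def
    using bij_betw_inv_into_left[OF bij] bij_betw_inv_into_right[OF bij] bij_betw_apply[OF bij]
    by (simp_all cong: restrict_cong del: mem_Sigma_iff)
  then show ?thesis
    using \<Omega> \<Omega>' \<psi> \<chi> unfolding iso_rel_def GES_cat_def by auto
qed

end

theorem theorem2p16:
  fixes H :: "('h, 'x) monoid_scheme" and S :: "'s set" and e :: 's
  assumes "group H" and "e \<in> S"
  shows "\<exists>\<phi>. bij_betw \<phi> (iso_classes (GES_cat H S e)) (K2 H S e)"
proof -
  have "iso_rel (GES_cat H S e) = ges_equiv H S e"
    using iso_imp_ges_equiv[OF assms] ges_equiv_imp_iso[OF assms] by auto
  then have "iso_classes (GES_cat H S e) = K2 H S e"
    by (simp add: iso_classes_def K2_def GES_cat_def)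
  then show ?thesis by (auto intro: bij_betw_id)
qed

end
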